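(* Let $D=(A,B,\lambda)$ be a temporal bi-clique with $A,B$ nonempty and $\lambda$ injective. Then $D$ is extremally matched or $D$ has a dismountable vertex.
   Context: A temporal bi-clique $(A,B,\lambda)$ is the complete bipartite graph with disjoint parts $A,B$ with an edge labeling $\lambda$ into $\mathbb{N}$. For a vertex $v$, $\pi^-(v)$ is the neighbor $u$ of $v$ minimizing $\lambda(\{v,u\})$ and $\pi^+(v)$ the neighbor maximizing it. $D$ is extremally matched if both $\{\{v,\pi^-(v)\}: v\in A\cup B\}$ and $\{\{v,\pi^+(v)\}: v\in A\cup B\}$ are perfect matchings of the complete bipartite graph on $A\sqcup B$. A vertex $a\in A$ is dismountable if there is $a'\in A$, $a'\ne a$, with $\lambda(\{a,\pi^-(a')\})\le\lambda(\{a',\pi^-(a')\})$. A vertex $b\in B$ is dismountable if there is $b'\in B$, $b'\ne b$, with $\lambda(\{b',\pi^+(b')\})\le\lambda(\{b,\pi^+(b')\})$. *)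

theory Defs
  imports Main
begin

definition biclique_edges :: "'a set \<Rightarrow> 'a set \<Rightarrow> 'a set set" where
  "biclique_edges A B = {{a, b} | a b. a \<in> A \<and> b \<in> B}"

text \<open>Graphs are finite. The labeling is a total function on vertex sets; only its
  values on \<^term>\<open>biclique_edges A B\<close> are ever used.\<close>

definition temporal_biclique :: "'a set \<Rightarrow> 'a set \<Rightarrow> ('a set \<Rightarrow> nat) \<Rightarrow> bool" where
  "temporal_biclique A B lam \<longleftrightarrow> finite A \<and> finite B \<and> A \<inter> B = {}"

definition neighbors :: "'a set \<Rightarrow> 'a set \<Rightarrow> 'a \<Rightarrow> 'a set" where
  "neighbors A B v = {u. {v, u} \<in> biclique_edges A B}"

definition pi_minus :: "'a set \<Rightarrow> 'a set \<Rightarrow> ('a set \<Rightarrow> nat) \<Rightarrow> 'a \<Rightarrow> 'a" where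
  "pi_minus A B lam v = arg_min_on (\<lambda>u. lam {v, u}) (neighbors A B v)"

definition pi_plus :: "'a set \<Rightarrow> 'a set \<Rightarrow> ('a set \<Rightarrow> nat) \<Rightarrow> 'a \<Rightarrow> 'a" where
  "pi_plus A B lam v = arg_max_on (\<lambda>u. lam {v, u}) (neighbors A B v)"

definition perfect_matching :: "'a set \<Rightarrow> 'a set \<Rightarrow> 'a set set \<Rightarrow> bool" where
  "perfect_matching A B M \<longleftrightarrow>
     M \<subseteq> biclique_edges A B \<and> (\<forall>v \<in> A \<union> B. \<exists>!e. e \<in> M \<and> v \<in> e)"

definition extremally_matched :: "'a set \<Rightarrow> 'a set \<Rightarrow> ('a set \<Rightarrow> nat) \<Rightarrow> bool" where
  "extremally_matched A B lam \<longleftrightarrow>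
     perfect_matching A B {{v, pi_minus A B lam v} | v. v \<in> A \<union> B} \<and>
     perfect_matching A B {{v, pi_plus A B lam v} | v. v \<in> A \<union> B}"

definition dismountable :: "'a set \<Rightarrow> 'a set \<Rightarrow> ('a set \<Rightarrow> nat) \<Rightarrow> 'a \<Rightarrow> bool" where
  "dismountable A B lam v \<longleftrightarrow>
     (v \<in> A \<and> (\<exists>a' \<in> A. a' \<noteq> v \<and>
        lam {v, pi_minus A B lam a'} \<le> lam {a', pi_minus A B lam a'})) \<or>
     (v \<in> B \<and> (\<exists>b' \<in> B. b' \<noteq> v \<and>
        lam {b', pi_plus A B lam b'} \<le> lam {v, pi_plus A B lam b'}))"

end

theory Submission
  imports Defs
begin

text \<open>If no vertex of \<open>A\<close> is dismountable, then every \<open>a \<in> A\<close> is the strict minimizer seen from its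
  earliest neighbor, so \<open>\<pi>\<^sup>-\<close> is inverted by itself on \<open>A\<close> and \<open>|A| \<le> |B|\<close>. Dually, if no vertex
  of \<open>B\<close> is dismountable, then \<open>\<pi>\<^sup>+\<close> is inverted by itself on \<open>B\<close> and \<open>|B| \<le> |A|\<close>. The two
  injections are therefore bijections, and self-inverse bijections between the parts are perfect
  matchings.\<close>

lemma biclique_edges_commute: "biclique_edges A B = biclique_edges B A"
  unfolding biclique_edges_def by (auto simp: insert_commute)

lemma perfect_matching_commute: "perfect_matching A B M \<longleftrightarrow> perfect_matching B A M"
  unfolding perfect_matching_def by (simp add: biclique_edges_commute Un_commute)

lemma neighbors_commute: "neighbors A B = neighbors B A"
  by (intro ext) (simp add: neighbors_def biclique_edges_commute)

lemma neighbors_left: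
  assumes "A \<inter> B = {}" "a \<in> A"
  shows "neighbors A B a = B"
  using assms unfolding neighbors_def biclique_edges_def by (auto simp: doubleton_eq_iff)

lemma neighbors_right:
  assumes "A \<inter> B = {}" "b \<in> B"
  shows "neighbors A B b = A"
  using neighbors_left[of B A b] assms by (simp add: neighbors_commute[of A B] Int_commute)

text \<open>\<open>arg_max_on\<close> is a choice, so its properties depend on a maximum being
  attained; finiteness supplies the bound that ensures this.\<close>

lemma arg_max_on_nat_if_finite:
  fixes f :: "'a \<Rightarrow> nat"
  assumes "finite S" "S \<noteq> {}"
  shows "arg_max_on f S \<in> S" and "x \<in> S \<Longrightarrow> f x \<le> f (arg_max_on f S)"
proof -
  obtain k where "k \<in> S"
    using assms by blast
  \<comment> \<open>The bound has to be strict, hence the \<open>Suc\<close>.\<close>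
  moreover have "\<forall>y. y \<in> S \<longrightarrow> f y < Suc (Max (f ` S))"
    using assms by (simp add: less_Suc_eq_le)
  ultimately have "arg_max_on f S \<in> S \<and> (\<forall>y. y \<in> S \<longrightarrow> f y \<le> f (arg_max_on f S))"
    unfolding arg_max_on_def by (rule arg_max_nat_lemma)
  then show "arg_max_on f S \<in> S" and "x \<in> S \<Longrightarrow> f x \<le> f (arg_max_on f S)"
    by auto
qed

lemma pi_minus_in_right:
  assumes "A \<inter> B = {}" "finite B" "B \<noteq> {}" "a \<in> A"
  shows "pi_minus A B lam a \<in> B"
  using assms by (simp add: pi_minus_def neighbors_left arg_min_if_finite)

lemma pi_plus_in_left:
  assumes "A \<inter> B = {}" "finite A" "A \<noteq> {}" "b \<in> B"
  shows "pi_plus A B lam b \<in> A"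
  using assms by (simp add: pi_plus_def neighbors_right arg_max_on_nat_if_finite)

text \<open>Strictness excludes ties, so the choice made by \<open>arg_min_on\<close> at
  \<open>b\<close> is forced.\<close>

lemma pi_minus_eq_strict_min:
  assumes "A \<inter> B = {}" "finite A" "b \<in> B" "a \<in> A"
    and "\<And>a'. a' \<in> A \<Longrightarrow> a' \<noteq> a \<Longrightarrow> lam {a, b} < lam {a', b}"
  shows "pi_minus A B lam b = a"
proof (rule ccontr)
  assume "pi_minus A B lam b \<noteq> a"
  moreover have "pi_minus A B lam b \<in> A" "\<not> lam {b, a} < lam {b, pi_minus A B lam b}"
    using arg_min_if_finite[of A "\<lambda>u. lam {b, u}"] assms(1-4)
    by (auto simp: pi_minus_def neighbors_right)
  ultimately show False
    using assms(5) by (metis insert_commute)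
qed

lemma pi_plus_eq_strict_max:
  assumes "A \<inter> B = {}" "finite B" "a \<in> A" "b \<in> B"
    and "\<And>b'. b' \<in> B \<Longrightarrow> b' \<noteq> b \<Longrightarrow> lam {b', a} < lam {b, a}"
  shows "pi_plus A B lam a = b"
proof (rule ccontr)
  assume "pi_plus A B lam a \<noteq> b"
  moreover have "pi_plus A B lam a \<in> B" "lam {a, b} \<le> lam {a, pi_plus A B lam a}"
    using arg_max_on_nat_if_finite[where S = B and f = "\<lambda>u. lam {a, u}"] assms(1-4)
    by (auto simp: pi_plus_def neighbors_left)
  ultimately show False
    using assms(5) by (metis insert_commute not_le)
qed

text \<open>The inverse law makes \<open>g\<close> injective on \<open>A\<close>, and the
  cardinality bound then makes it onto \<open>B\<close>. Hence the law on \<open>A\<close> alone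
  also controls \<open>g\<close> on \<open>B\<close>.\<close>

lemma perfect_matching_self_inverse:
  assumes "A \<inter> B = {}" "finite B" "card B \<le> card A"
    and into: "\<And>a. a \<in> A \<Longrightarrow> g a \<in> B"
    and inv: "\<And>a. a \<in> A \<Longrightarrow> g (g a) = a"
  shows "perfect_matching A B {{v, g v} | v. v \<in> A \<union> B}"
proof -
  have "inj_on g A"
    by (metis inj_onI inv)
  then have "card (g ` A) = card A"
    by (rule card_image)
  then have surj: "g ` A = B"
    using assms by (intro card_seteq) auto
  \<comment> \<open>Vertices of \<open>B\<close> add no new edges: for \<open>b = g a\<close>, the
    edge at \<open>b\<close> is \<open>{g a, a}\<close>.\<close>
  have M: "{{v, g v} | v. v \<in> A \<union> B} = {{a, g a} | a. a \<in> A}"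
    unfolding surj[symmetric] using inv by (auto simp: insert_commute)
  have "\<exists>!e. e \<in> {{a, g a} | a. a \<in> A} \<and> v \<in> e" if v: "v \<in> A \<union> B" for v
  proof -
    obtain a where a: "a \<in> A" "v = a \<or> v = g a"
      using v surj by blast
    \<comment> \<open>A vertex of \<open>A\<close> can only be the left end of an edge, by
      disjointness; a vertex of \<open>B\<close> recovers its left end by applying
      \<open>g\<close>.\<close>
    have uniq: "a' = a" if a': "a' \<in> A" "v \<in> {a', g a'}" for a'
    proof (cases "v \<in> A")
      case True
      then show ?thesis
        using a a' into[of a] into[of a'] \<open>A \<inter> B = {}\<close> by blast
    next
      case False
      then have "v = g a" "v = g a'"
        using a a' by auto
      then show ?thesis
        using inv[of a] inv[of a'] a(1) a'(1) by simp
    qed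
    show ?thesis
    proof (rule ex1I)
      show "{a, g a} \<in> {{a, g a} | a. a \<in> A} \<and> v \<in> {a, g a}"
        using a by blast
      show "e = {a, g a}" if "e \<in> {{a, g a} | a. a \<in> A} \<and> v \<in> e" for e
        using that uniq by blast
    qed
  qed
  moreover have "{{a, g a} | a. a \<in> A} \<subseteq> biclique_edges A B"
    unfolding biclique_edges_def using into by blast
  ultimately show ?thesis
    unfolding M perfect_matching_def by (intro conjI ballI)
qed

theorem theorem16:
  fixes A B :: "'a set" and lam :: "'a set \<Rightarrow> nat"
  assumes "temporal_biclique A B lam"
    and "A \<noteq> {}" and "B \<noteq> {}"
    and "inj_on lam (biclique_edges A B)"
  shows "extremally_matched A B lam \<or> (\<exists>v \<in> A \<union> B. dismountable A B lam v)"
proof (rule disjCI)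
  assume nd: "\<not> (\<exists>v \<in> A \<union> B. dismountable A B lam v)"
  let ?m = "pi_minus A B lam" and ?p = "pi_plus A B lam"
  have fin: "finite A" "finite B" and disj: "A \<inter> B = {}"
    using assms(1) by (auto simp: temporal_biclique_def)
  have m: "?m a \<in> B" if "a \<in> A" for a
    using that disj fin assms(3) by (intro pi_minus_in_right)
  have p: "?p b \<in> A" if "b \<in> B" for b
    using that disj fin assms(2) by (intro pi_plus_in_left)
  \<comment> \<open>Otherwise \<open>a'\<close> would be dismountable with witness
    \<open>a\<close>.\<close>
  have "lam {a, ?m a} < lam {a', ?m a}" if "a \<in> A" "a' \<in> A" "a' \<noteq> a" for a a'
    using nd that unfolding dismountable_def by (metis UnI1 not_le)
  then have mm: "?m (?m a) = a" if "a \<in> A" for a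
    using that by (intro pi_minus_eq_strict_min disj fin m)
  \<comment> \<open>Otherwise \<open>b'\<close> would be dismountable with witness
    \<open>b\<close>.\<close>
  have "lam {b', ?p b} < lam {b, ?p b}" if "b \<in> B" "b' \<in> B" "b' \<noteq> b" for b b'
    using nd that unfolding dismountable_def by (metis UnI2 not_le)
  then have pp: "?p (?p b) = b" if "b \<in> B" for b
    using that by (intro pi_plus_eq_strict_max disj fin p)
  have "card A \<le> card B"
    using fin m mm by (intro card_inj_on_le[of ?m]) (auto intro: inj_on_inverseI)
  moreover have "card B \<le> card A"
    using fin p pp by (intro card_inj_on_le[of ?p]) (auto intro: inj_on_inverseI)
  \<comment> \<open>For \<open>?p\<close> the two parts swap roles, since its inverse law is known
    on \<open>B\<close>; the symmetry of \<open>perfect_matching\<close> undoes the swap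
    afterwards.\<close>
  ultimately have "perfect_matching A B {{v, ?m v} | v. v \<in> A \<union> B}"
    and "perfect_matching B A {{v, ?p v} | v. v \<in> B \<union> A}"
    using disj fin m mm p pp perfect_matching_self_inverse[of A B ?m]
      perfect_matching_self_inverse[of B A ?p] by (simp_all add: Int_commute)
  then show "extremally_matched A B lam"
    by (simp add: extremally_matched_def perfect_matching_commute[of B A] Un_commute)
qed

end
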